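(* Let $n\ge 1$ and let $a_1,\dots,a_n$ be pairwise relatively prime positive integers. Let $$\mathcal P=\Big\{(x_1,\dots,x_n)\in\mathbb R^n : x_k\ge 0 \text{ for all } k,\ \sum_{k=1}^n a_kx_k\le 1\Big\},$$ let $\mathcal P^\circ$ be its interior, and for a positive integer $t$ let $$L(\mathcal P^\circ,t)=\#(t\mathcal P^\circ\cap\mathbb Z^n)=\#\Big\{(m_1,\dots,m_n)\in\mathbb Z^n: m_k>0 \text{ for all } k,\ \sum_{k=1}^n m_ka_k<t\Big\}.$$ Then for every positive integer $t$, $$L(\mathcal P^\circ,t)=(-1)^nR_t(a_1,\dots,a_n)+\sum_{j=1}^n\sigma_t(a_1,\dots,\hat a_j,\dots,a_n,1;a_j),$$ where $\hat a_j$ means that the entry $a_j$ is omitted, and $R_t(a_1,\dots,a_n)=-\operatorname{Res}(F_t(z),z=1)$ with $$F_t(z)=\frac{z^{t-1}}{(1-z^{a_1})\cdots(1-z^{a_n})(1-z)}.$$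
   Context: Fourier-Dedekind sum: for integers $c_1,\dots,c_m$ each relatively prime to a positive integer $c$, and $t\in\mathbb Z$, $$\sigma_t(c_1,\dots,c_m;c)=\frac1c\sum_{\lambda^c=1,\ \lambda\ne1}\frac{\lambda^t}{(\lambda^{c_1}-1)\cdots(\lambda^{c_m}-1)},$$ the sum being over all complex $c$-th roots of unity $\lambda\neq 1$ (so it is $0$ if $c=1$). $\operatorname{Res}(F(z),z=1)$ denotes the residue of the meromorphic function $F$ at $z=1$. *)

theory Defs
  imports "HOL-Complex_Analysis.Complex_Analysis" "HOL-Library.Multiset"
begin

(* The sum is symmetric in c_1, ..., c_m, so these are given as a multiset (repeated entries
   count repeatedly). It is meant for c > 0 and all entries of cs coprime to c; then no
   denominator vanishes. *)
definition fourier_dedekind :: "int \<Rightarrow> int multiset \<Rightarrow> nat \<Rightarrow> complex" where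
  "fourier_dedekind t cs c =
     1 / of_nat c * (\<Sum>w\<in>{w::complex. w ^ c = 1 \<and> w \<noteq> 1}.
        w powi t / (\<Prod>d\<in>#cs. (w powi d - 1)))"

definition weighted_simplex :: "('n::finite \<Rightarrow> nat) \<Rightarrow> (real ^ 'n) set" where
  "weighted_simplex a = {x. (\<forall>k. 0 \<le> x $ k) \<and> (\<Sum>k\<in>UNIV. real (a k) * x $ k) \<le> 1}"

definition integer_lattice :: "(real ^ 'n) set" where
  "integer_lattice = {x. \<forall>k. x $ k \<in> \<int>}"

definition lattice_count :: "(real ^ 'n) set \<Rightarrow> nat \<Rightarrow> nat" where
  "lattice_count S t = card ((\<lambda>x. real t *\<^sub>R x) ` S \<inter> integer_lattice)"

definition F_fun :: "('n::finite \<Rightarrow> nat) \<Rightarrow> int \<Rightarrow> complex \<Rightarrow> complex" where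
  "F_fun a t z = z powi (t - 1) / ((\<Prod>k\<in>UNIV. 1 - z ^ a k) * (1 - z))"

definition R_term :: "('n::finite \<Rightarrow> nat) \<Rightarrow> int \<Rightarrow> complex" where
  "R_term a t = - residue (F_fun a t) 1"

end

theory Submission
  imports Defs
begin

text \<open>
  The number of lattice points is the \<open>t\<close>-th coefficient of
  \<open>(\<Prod>k. X ^ a k / (1 - X ^ a k)) * X / (1 - X)\<close>. By Cauchy's formula this is an integral over a small
  circle (up to \<open>2 * pi * \<i>\<close>), which the inversion \<open>z \<mapsto> 1 / z\<close> turns into \<open>(-1) ^ Suc n\<close> times the integral
  of \<open>F_fun a t\<close> over a circle enclosing all its poles. As the \<open>a k\<close> are pairwise coprime, the poles
  other than 1 are simple, and the residues at the nontrivial \<open>a j\<close>-th roots of unity add up to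
  the \<open>j\<close>-th Fourier-Dedekind sum times the same sign.
\<close>

no_notation fps_nth (infixl "$" 75)

section \<open>The generating function of the lattice points\<close>

lemma dvd_diff_prod:
  fixes f g :: "'a \<Rightarrow> 'b::comm_ring_1"
  assumes "\<And>x. x \<in> S \<Longrightarrow> d dvd f x - g x"
  shows "d dvd prod f S - prod g S"
  using assms
proof (induction S rule: infinite_finite_induct)
  case (insert x S)
  have "prod f (insert x S) - prod g (insert x S)
      = (f x - g x) * prod f S + g x * (prod f S - prod g S)"
    using insert by (simp add: algebra_simps)
  with insert show ?case by auto
qed auto

lemma fps_nth_X_over_one_minus_X:
  "fps_nth (fps_X * inverse (1 - fps_X :: 'a::field fps)) n = (if n = 0 then 0 else 1)"
  by (simp add: fps_inverse_gp'[symmetric])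

text \<open>Each factor is the geometric series of the powers \<open>fps_X ^ (a k * m)\<close> with
  \<open>m > 0\<close>, and multiplying by \<open>fps_X * inverse (1 - fps_X)\<close> adds up the
  coefficients of all smaller indices. As \<open>a k > 0\<close>, only \<open>m \<le> t\<close>
  matters modulo \<open>fps_X ^ Suc t\<close>, which leaves a finite sum.\<close>

lemma fps_nth_prod_geometric:
  fixes a :: "'a \<Rightarrow> nat"
  assumes "finite S" and pos: "\<And>k. k \<in> S \<Longrightarrow> a k > 0"
  shows "fps_nth ((\<Prod>k\<in>S. fps_X ^ a k * inverse (1 - fps_X ^ a k)) *
           (fps_X * inverse (1 - fps_X)) :: 'b::field fps) t =
         of_nat (card {f \<in> S \<rightarrow>\<^sub>E {1..t}. (\<Sum>k\<in>S. a k * f k) < t})"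
proof -
  let ?E = "\<lambda>k. fps_X ^ a k * inverse (1 - fps_X ^ a k) :: 'b fps"
  let ?P = "\<lambda>k. \<Sum>m\<in>{1..t}. (fps_X ^ a k) ^ m :: 'b fps"
  let ?Z = "fps_X * inverse (1 - fps_X) :: 'b fps"
  have "fps_X ^ Suc t dvd ?E k - ?P k" if "k \<in> S" for k
  proof -
    let ?Y = "fps_X ^ a k :: 'b fps"
    have inv: "inverse (1 - ?Y) * (1 - ?Y) = 1"
      using pos[OF that] by (intro inverse_mult_eq_1) auto
    have "(1 - ?Y) * ?P k = ?Y - ?Y ^ Suc t"
      \<comment> \<open>\<open>sum_gp_multiplied\<close> needs a nonempty range; for
        \<open>t = 0\<close> both sides vanish.\<close>
      by (cases "t = 0") (auto simp: sum_gp_multiplied)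
    hence "inverse (1 - ?Y) * ((1 - ?Y) * ?P k) = inverse (1 - ?Y) * (?Y - ?Y ^ Suc t)"
      by (rule arg_cong)
    also have "\<dots> = ?E k - inverse (1 - ?Y) * ?Y ^ Suc t"
      by (simp only: right_diff_distrib mult.commute)
    finally have "?P k = ?E k - inverse (1 - ?Y) * ?Y ^ Suc t"
      unfolding mult.assoc[symmetric] inv by simp
    hence "?E k - ?P k = inverse (1 - ?Y) * ?Y ^ Suc t"
      by simp
    moreover have "fps_X ^ Suc t dvd ?Y ^ Suc t"
      using pos[OF that] by (intro dvd_power_same dvd_power) auto
    ultimately show ?thesis by simp
  qed
  \<comment> \<open>Congruence modulo \<open>fps_X ^ Suc t\<close> passes from the factors to the
    product, so truncating the series does not change the coefficient of index
    \<open>t\<close>.\<close>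
  hence "fps_X ^ Suc t dvd prod ?E S - prod ?P S"
    by (rule dvd_diff_prod)
  then obtain R where R: "prod ?E S - prod ?P S = fps_X ^ Suc t * R" ..
  have "fps_nth (prod ?E S * ?Z) t
      = fps_nth (prod ?P S * ?Z) t + fps_nth (fps_X ^ Suc t * (R * ?Z)) t"
    by (simp only: fps_add_nth[symmetric] mult.assoc[symmetric] R[symmetric]) (simp add: algebra_simps)
  also have "fps_nth (fps_X ^ Suc t * (R * ?Z)) t = 0"
    by (subst fps_X_power_mult_nth) simp
  also have "prod ?P S = (\<Sum>f\<in>S \<rightarrow>\<^sub>E {1..t}. fps_X ^ (\<Sum>k\<in>S. a k * f k))"
    using assms(1) by (subst prod_sum_PiE) (auto simp: power_sum power_mult)
  \<comment> \<open>A term with exponent \<open>s \<le> t\<close> contributes the coefficient of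
    \<open>?Z\<close> of index \<open>t - s\<close>. It is 0 at index 0, which makes the inequality
    strict.\<close>
  also have "fps_nth (\<dots> * ?Z) t
      = (\<Sum>f\<in>S \<rightarrow>\<^sub>E {1..t}. if (\<Sum>k\<in>S. a k * f k) < t then 1 else 0)"
    unfolding sum_distrib_right fps_sum_nth fps_X_power_mult_nth fps_nth_X_over_one_minus_X
    by (intro sum.cong) auto
  also have "\<dots> = of_nat (card {f \<in> S \<rightarrow>\<^sub>E {1..t}. (\<Sum>k\<in>S. a k * f k) < t})"
    using assms(1) by (simp add: sum.If_cases finite_PiE Int_def)
  finally show ?thesis by simp
qed

section \<open>Lattice points in the interior of the dilated simplex\<close>

lemma interior_weighted_simplex:
  fixes a :: "'n::finite \<Rightarrow> nat"
  assumes "\<And>k. a k > 0"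
  shows "interior (weighted_simplex a) =
    {x. (\<forall>k. 0 < x $ k) \<and> (\<Sum>k\<in>UNIV. real (a k) * x $ k) < 1}"
proof -
  let ?v = "(\<chi> k. real (a k)) :: real ^ 'n"
  have "?v \<noteq> 0"
    using assms by (auto simp: vec_eq_iff)
  \<comment> \<open>The simplex is a finite intersection of half-spaces, and \<open>interior\<close>
    commutes with finite intersections. Replacing \<open>UNIV\<close> by an arbitrary
    \<open>A\<close> makes induction possible.\<close>
  have "interior (\<Inter>k\<in>A. {x :: real ^ 'n. 0 \<le> x $ k}) = (\<Inter>k\<in>A. {x. 0 < x $ k})" for A
    using finite[of A] by (induction A rule: finite_induct) auto
  moreover have "weighted_simplex a = (\<Inter>k\<in>UNIV. {x. 0 \<le> x $ k}) \<inter> {x. ?v \<bullet> x \<le> 1}"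
    by (auto simp: weighted_simplex_def inner_vec_def)
  ultimately have "interior (weighted_simplex a) = (\<Inter>k\<in>UNIV. {x. 0 < x $ k}) \<inter> {x. ?v \<bullet> x < 1}"
    by (simp add: interior_halfspace_le[OF \<open>?v \<noteq> 0\<close>])
  thus ?thesis
    by (auto simp: inner_vec_def)
qed

text \<open>Dilation by \<open>t\<close> moves the bound 1 to \<open>t\<close>, and the injective
  coordinatewise embedding \<open>?h\<close> of the integer vectors has the lattice as its
  range.\<close>

lemma lattice_count_interior_weighted_simplex:
  fixes a :: "'n::finite \<Rightarrow> nat"
  assumes a_pos: "\<And>k. a k > 0" and t_pos: "t > 0"
  shows "lattice_count (interior (weighted_simplex a)) t =
    card {m :: int ^ 'n. (\<forall>k. m $ k > 0) \<and> (\<Sum>k\<in>UNIV. m $ k * int (a k)) < int t}"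
proof -
  let ?I = "{x :: real ^ 'n. (\<forall>k. 0 < x $ k) \<and> (\<Sum>k\<in>UNIV. real (a k) * x $ k) < 1}"
  let ?T = "{x :: real ^ 'n. (\<forall>k. 0 < x $ k) \<and> (\<Sum>k\<in>UNIV. real (a k) * x $ k) < real t}"
  let ?M = "{m :: int ^ 'n. (\<forall>k. m $ k > 0) \<and> (\<Sum>k\<in>UNIV. m $ k * int (a k)) < int t}"
  let ?h = "\<lambda>m :: int ^ 'n. (\<chi> k. real_of_int (m $ k)) :: real ^ 'n"
  have scale: "(\<lambda>x. real t *\<^sub>R x) ` ?I = ?T"
  proof (intro equalityI subsetI)
    fix x assume "x \<in> (\<lambda>x. real t *\<^sub>R x) ` ?I"
    then obtain y where y: "y \<in> ?I" "x = real t *\<^sub>R y" by blast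
    have "(\<Sum>k\<in>UNIV. real (a k) * x $ k) = real t * (\<Sum>k\<in>UNIV. real (a k) * y $ k)"
      by (simp add: y sum_distrib_left mult_ac)
    with y t_pos show "x \<in> ?T" by auto
  next
    fix x assume x: "x \<in> ?T"
    let ?y = "(1 / real t) *\<^sub>R x"
    have "(\<Sum>k\<in>UNIV. real (a k) * ?y $ k) = (\<Sum>k\<in>UNIV. real (a k) * x $ k) / real t"
      by (simp add: sum_divide_distrib)
    with x t_pos have "?y \<in> ?I" by auto
    moreover have "x = real t *\<^sub>R ?y" using t_pos by simp
    ultimately show "x \<in> (\<lambda>x. real t *\<^sub>R x) ` ?I" by blast
  qed
  have h_iff: "?h m \<in> ?T \<longleftrightarrow> m \<in> ?M" for m
  proof -
    have "(\<Sum>k\<in>UNIV. real (a k) * ?h m $ k) = real_of_int (\<Sum>k\<in>UNIV. m $ k * int (a k))"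
      by (simp add: mult.commute)
    moreover have "real_of_int (\<Sum>k\<in>UNIV. m $ k * int (a k)) < real t \<longleftrightarrow>
        (\<Sum>k\<in>UNIV. m $ k * int (a k)) < int t"
      by linarith
    ultimately show ?thesis by simp
  qed
  have "range ?h = integer_lattice"
  proof (intro equalityI subsetI)
    fix x :: "real ^ 'n" assume "x \<in> integer_lattice"
    hence "x = ?h (\<chi> k. \<lfloor>x $ k\<rfloor>)"
      by (auto simp: integer_lattice_def vec_eq_iff)
    thus "x \<in> range ?h" by blast
  qed (auto simp: integer_lattice_def)
  hence "?T \<inter> integer_lattice = ?h ` ?M"
    using h_iff by fast
  moreover have "inj_on ?h ?M"
    by (auto simp: inj_on_def vec_eq_iff)
  ultimately show ?thesis
    unfolding lattice_count_def interior_weighted_simplex[OF a_pos] scale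
    by (simp only: card_image)
qed

text \<open>This links the lattice points to the functions counted by the generating function. The
  upper limit \<open>t\<close> on the values loses nothing: \<open>f k \<le> a k * f k\<close>,
  which is at most the whole sum.\<close>

lemma card_positive_int_vectors:
  fixes a :: "'n::finite \<Rightarrow> nat"
  assumes a_pos: "\<And>k. a k > 0"
  shows "card {m :: int ^ 'n. (\<forall>k. m $ k > 0) \<and> (\<Sum>k\<in>UNIV. m $ k * int (a k)) < int t} =
    card {f \<in> UNIV \<rightarrow>\<^sub>E {1..t}. (\<Sum>k\<in>UNIV. a k * f k) < t}"
proof -
  let ?M = "{m :: int ^ 'n. (\<forall>k. m $ k > 0) \<and> (\<Sum>k\<in>UNIV. m $ k * int (a k)) < int t}"
  let ?A = "{f \<in> UNIV \<rightarrow>\<^sub>E {1..t}. (\<Sum>k\<in>UNIV. a k * f k) < t}"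
  have sum_eq: "(\<Sum>k\<in>UNIV. int (f k) * int (a k)) = int (\<Sum>k\<in>UNIV. a k * f k)" for f
    by (simp add: mult.commute)
  have "bij_betw (\<lambda>f. \<chi> k. int (f k)) ?A ?M"
  proof (rule bij_betwI[where g = "\<lambda>m k. nat (m $ k)"])
    show "(\<lambda>f. \<chi> k. int (f k)) \<in> ?A \<rightarrow> ?M"
      using sum_eq by (auto simp: PiE_def Pi_def Suc_le_eq simp del: of_nat_sum)
    show "(\<lambda>m k. nat (m $ k)) \<in> ?M \<rightarrow> ?A"
    proof
      fix m assume m: "m \<in> ?M"
      define f where "f = (\<lambda>k. nat (m $ k))"
      have f: "m $ k = int (f k)" "f k > 0" for k
        using m by (auto simp: f_def order.strict_implies_order)
      have less: "(\<Sum>k\<in>UNIV. a k * f k) < t"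
        using m sum_eq[of f] by (simp add: f(1) del: of_nat_sum)
      have "f k \<le> t" for k
      proof -
        have "f k \<le> a k * f k" using a_pos[of k] by simp
        also have "\<dots> \<le> (\<Sum>k\<in>UNIV. a k * f k)" by (intro member_le_sum) auto
        finally show ?thesis using less by simp
      qed
      with f less have "f \<in> ?A" by (auto simp: Suc_le_eq)
      thus "(\<lambda>k. nat (m $ k)) \<in> ?A" by (simp add: f_def)
    qed
  qed (auto simp: vec_eq_iff order.strict_implies_order)
  thus ?thesis by (simp add: bij_betw_same_card)
qed

section \<open>Contour integrals under inversion\<close>

lemma contour_integral_circlepath_inverse:
  assumes "r > 0"
  shows "contour_integral (circlepath 0 r) f =
    contour_integral (circlepath 0 (1 / r)) (\<lambda>z. f (1 / z) / z\<^sup>2)"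
proof -
  \<comment> \<open>Inversion turns radius \<open>1 / r\<close> into \<open>r\<close> and negates
    the angle, so the circle is run through backwards.\<close>
  have inv: "(\<lambda>z. 1 / z) \<circ> circlepath 0 (1 / r) = reversepath (circlepath 0 r)"
    using assms
    by (auto simp: fun_eq_iff circlepath_def part_circlepath_def reversepath_def linepath_def
          exp_minus[symmetric] divide_inverse algebra_simps exp_diff exp_add simp flip: exp_of_real)
  have "- contour_integral (circlepath 0 r) f
      = contour_integral ((\<lambda>z. 1 / z) \<circ> circlepath 0 (1 / r)) f"
    unfolding inv by (rule contour_integral_reversepath[symmetric]) auto
  also have "\<dots> = contour_integral (circlepath 0 (1 / r)) (\<lambda>z. deriv (\<lambda>z. 1 / z) z * f (1 / z))"
    by (rule contour_integral_comp_analyticW[where s = "- {0}"])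
       (use assms in \<open>auto intro!: analytic_intros\<close>)
  also have "\<dots> = contour_integral (circlepath 0 (1 / r)) (\<lambda>z. - (f (1 / z) / z\<^sup>2))"
  proof (rule contour_integral_eq)
    fix z :: complex assume "z \<in> path_image (circlepath 0 (1 / r))"
    hence "z \<noteq> 0" using assms by auto
    \<comment> \<open>The minus sign of this derivative cancels the one from the reversed
      orientation.\<close>
    hence "((\<lambda>z. 1 / z) has_field_derivative - (1 / z\<^sup>2)) (at z)"
      by (auto intro!: derivative_eq_intros simp: power2_eq_square)
    thus "deriv (\<lambda>z. 1 / z) z * f (1 / z) = - (f (1 / z) / z\<^sup>2)"
      by (simp add: DERIV_imp_deriv)
  qed
  also have "\<dots> = - contour_integral (circlepath 0 (1 / r)) (\<lambda>z. f (1 / z) / z\<^sup>2)"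
    by (rule contour_integral_neg)
  finally show ?thesis by simp
qed

section \<open>Roots of unity\<close>

lemma norm_root_of_unity:
  fixes w :: complex
  assumes "w ^ n = 1" "n > 0"
  shows "norm w = 1"
  using assms by (metis norm_one norm_power power_eq_1_iff norm_ge_zero power_eq_imp_eq_base power_one zero_le_one)

text \<open>Bezout gives \<open>w = w ^ (n * y + 1) = w ^ (m * x) = 1\<close>. Hence for pairwise
  coprime exponents a nontrivial root of unity is a zero of at most one factor
  \<open>1 - z ^ a k\<close>.\<close>

lemma coprime_roots_of_unity_eq_1:
  fixes w :: "'a::monoid_mult"
  assumes "w ^ m = 1" "w ^ n = 1" "coprime m n"
  shows "w = 1"
proof (cases "m = 0")
  case False
  then obtain x y where "m * x = n * y + 1"
    using bezout_nat[of m n] assms(3) by (auto simp: coprime_iff_gcd_eq_1)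
  have "w ^ (m * x) = 1" "w ^ (n * y) = 1"
    using assms by (simp_all add: power_mult)
  with \<open>m * x = n * y + 1\<close> show ?thesis by simp
qed (use assms in auto)

lemma prod_minus_swap:
  fixes f g :: "'a \<Rightarrow> 'b::comm_ring_1"
  shows "(\<Prod>x\<in>S. f x - g x) = (- 1) ^ card S * (\<Prod>x\<in>S. g x - f x)"
  by (simp flip: prod_constant prod.distrib)

section \<open>The contour integral as a power series coefficient\<close>

lemma contour_integral_F_fun:
  fixes a :: "'n::finite \<Rightarrow> nat"
  assumes a_pos: "\<And>k. a k > 0" and t_pos: "t > 0"
  shows "contour_integral (circlepath 0 2) (F_fun a (int t)) = 2 * pi * \<i> * ((- 1) ^ Suc CARD('n) *
     fps_nth ((\<Prod>k\<in>UNIV. fps_X ^ a k * inverse (1 - fps_X ^ a k)) * (fps_X * inverse (1 - fps_X))) t)"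
proof -
  let ?G = "\<lambda>z :: complex. (\<Prod>k\<in>UNIV. z ^ a k * inverse (1 - z ^ a k)) * (z * inverse (1 - z))"
  let ?Gf = "(\<Prod>k\<in>UNIV. fps_X ^ a k * inverse (1 - fps_X ^ a k)) * (fps_X * inverse (1 - fps_X)) :: complex fps"
  \<comment> \<open>Roots of unity have norm 1, so the denominators of \<open>?G\<close> do not
    vanish on the disc of radius \<open>1 / 2\<close>.\<close>
  have ne: "z ^ n \<noteq> 1" if "norm z \<le> 1 / 2" "n > 0" for z :: complex and n
    using norm_root_of_unity[of z n] that by auto
  have holo: "?G holomorphic_on cball 0 (1 / 2)"
    using a_pos ne ne[of _ 1] by (auto intro!: holomorphic_intros)
  have expansion: "?G has_fps_expansion ?Gf"
    using a_pos by (intro fps_expansion_intros) auto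
  \<comment> \<open>Each of the \<open>CARD('n) + 1\<close> factors of the denominator yields a sign
    under inversion. The powers \<open>z ^ (t - 1)\<close> and \<open>z ^ 2\<close> combine to
    \<open>z ^ Suc t\<close> as \<open>t > 0\<close>, giving the Cauchy kernel of the
    \<open>t\<close>-th derivative at 0.\<close>
  have integrand: "F_fun a (int t) (1 / z) / z\<^sup>2 = (- 1) ^ Suc CARD('n) * (?G z / (z - 0) ^ Suc t)"
    if z: "z \<in> path_image (circlepath 0 (1 / 2))" for z
  proof -
    have "norm z \<le> 1 / 2" "z \<noteq> 0" using z by auto
    have nz: "1 - z \<noteq> 0" "1 - z ^ a k \<noteq> 0" for k
      using ne[of z 1] ne[of z "a k"] \<open>norm z \<le> 1 / 2\<close> a_pos by auto
    have "1 - (1 / z) ^ a k = (z ^ a k - 1) / z ^ a k" for k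
      using \<open>z \<noteq> 0\<close> by (simp add: field_simps)
    hence "(\<Prod>k\<in>UNIV. 1 - (1 / z) ^ a k) = (\<Prod>k\<in>UNIV. z ^ a k - 1) / (\<Prod>k\<in>UNIV. z ^ a k)"
      by (simp add: prod_dividef)
    also have "(\<Prod>k\<in>UNIV. z ^ a k - 1) = (- 1) ^ CARD('n) * (\<Prod>k\<in>UNIV. 1 - z ^ a k)"
      by (rule prod_minus_swap)
    finally have prod_eq: "(\<Prod>k\<in>UNIV. 1 - (1 / z) ^ a k) =
      (- 1) ^ CARD('n) * ((\<Prod>k\<in>UNIV. 1 - z ^ a k) / (\<Prod>k\<in>UNIV. z ^ a k))" by simp
    have G: "?G z = (\<Prod>k\<in>UNIV. z ^ a k) / (\<Prod>k\<in>UNIV. 1 - z ^ a k) * (z / (1 - z))"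
      by (simp add: prod_dividef flip: divide_inverse)
    have "(1 / z) powi (int t - 1) = 1 / z ^ (t - 1)"
      using t_pos by (simp add: power_int_def nat_diff_distrib power_one_over)
    moreover have "1 - 1 / z = - ((1 - z) / z)"
      using \<open>z \<noteq> 0\<close> by (simp add: field_simps)
    ultimately have "F_fun a (int t) (1 / z) =
        1 / z ^ (t - 1) / ((- 1) ^ CARD('n) *
          ((\<Prod>k\<in>UNIV. 1 - z ^ a k) / (\<Prod>k\<in>UNIV. z ^ a k)) * - ((1 - z) / z))"
      by (simp only: F_fun_def prod_eq)
    also have "\<dots> / z\<^sup>2 = (- 1) ^ Suc CARD('n) * (?G z / z ^ (t - 1 + 2))"
      unfolding G power_add
      by (cases "even CARD('n)") (simp_all add: divide_simps)
    also have "t - 1 + 2 = Suc t" using t_pos by simp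
    finally show ?thesis by simp
  qed
  have "((\<lambda>z. (- 1) ^ Suc CARD('n) * (?G z / (z - 0) ^ Suc t)) has_contour_integral
      (- 1) ^ Suc CARD('n) * (2 * pi * \<i> / fact t * (deriv ^^ t) ?G 0)) (circlepath 0 (1 / 2))"
    by (intro has_contour_integral_lmul Cauchy_has_contour_integral_higher_derivative_circlepath
          holomorphic_on_imp_continuous_on holo holomorphic_on_subset[OF holo]) auto
  hence "((\<lambda>z. F_fun a (int t) (1 / z) / z\<^sup>2) has_contour_integral
      (- 1) ^ Suc CARD('n) * (2 * pi * \<i> / fact t * (deriv ^^ t) ?G 0)) (circlepath 0 (1 / 2))"
    by (rule has_contour_integral_eq) (simp only: integrand)
  hence "contour_integral (circlepath 0 2) (F_fun a (int t)) =
      (- 1) ^ Suc CARD('n) * (2 * pi * \<i> / fact t * (deriv ^^ t) ?G 0)"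
    by (simp add: contour_integral_circlepath_inverse[of 2] contour_integral_unique)
  \<comment> \<open>The coefficient of index \<open>t\<close> is the \<open>t\<close>-th derivative
    at 0 divided by \<open>fact t\<close>.\<close>
  thus ?thesis
    using fps_nth_fps_expansion[OF expansion, of t] by simp
qed

section \<open>Residues at the roots of unity and the residue theorem\<close>

lemma residue_F_fun_root_of_unity:
  fixes a :: "'n::finite \<Rightarrow> nat"
  assumes a_pos: "\<And>k. a k > 0"
    and a_coprime: "\<And>i j. i \<noteq> j \<Longrightarrow> coprime (a i) (a j)"
    and t_pos: "t > 0" and w: "w ^ a j = 1" "w \<noteq> 1"
  shows "residue (F_fun a (int t)) w = (- 1) ^ Suc CARD('n) * (1 / of_nat (a j) *
    (w powi int t / (\<Prod>d\<in>#add_mset 1 {# int (a k). k \<in># mset_set (UNIV - {j}) #}. w powi d - 1)))"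
proof -
  let ?Q = "\<lambda>z :: complex. \<Prod>k\<in>UNIV - {j}. 1 - z ^ a k"
  let ?g = "\<lambda>z :: complex. (\<Prod>k\<in>UNIV. 1 - z ^ a k) * (1 - z)"
  let ?g' = "- (of_nat (a j) / w) * ?Q w * (1 - w)"
  have "w \<noteq> 0" using w(1) a_pos[of j] by (metis power_eq_0_iff zero_neq_one less_irrefl zero_power)
  \<comment> \<open>By coprimality, only the factor of index \<open>j\<close> vanishes at
    \<open>w\<close>, so the pole is simple.\<close>
  have "w ^ a k \<noteq> 1" if "k \<noteq> j" for k
    using coprime_roots_of_unity_eq_1[OF _ w(1) a_coprime[OF that]] w(2) by blast
  hence Q: "?Q w \<noteq> 0" by simp
  have "w * w ^ (a j - 1) = 1"
    using w(1) a_pos[of j] by (metis power_eq_if less_irrefl)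
  hence pw: "w ^ (a j - Suc 0) = 1 / w" using \<open>w \<noteq> 0\<close> by (simp add: field_simps)
  have split: "?g = (\<lambda>z. (1 - z ^ a j) * (?Q z * (1 - z)))"
    by (subst prod.remove[of UNIV j]) (auto simp: mult_ac)
  have "(\<lambda>z. ?Q z * (1 - z)) field_differentiable at w"
    by (rule holomorphic_on_imp_differentiable_at[of _ UNIV]) (auto intro!: holomorphic_intros)
  \<comment> \<open>The value of \<open>D\<close> is immaterial: in the product rule it is
    multiplied by \<open>1 - w ^ a j = 0\<close>.\<close>
  then obtain D where D: "((\<lambda>z. ?Q z * (1 - z)) has_field_derivative D) (at w)"
    by (auto simp: field_differentiable_def)
  have deriv: "(?g has_field_derivative ?g') (at w)"
    unfolding split
    by (rule derivative_eq_intros D | simp add: w pw)+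
  have g': "?g' \<noteq> 0"
    using Q \<open>w \<noteq> 0\<close> w(2) a_pos[of j] by simp
  have F: "F_fun a (int t) = (\<lambda>z. z ^ (t - 1) / ?g z)"
    using t_pos by (auto simp: F_fun_def power_int_def nat_diff_distrib fun_eq_iff)
  have "?g w = 0" using w(1) by auto
  hence "residue (F_fun a (int t)) w = w ^ (t - 1) / ?g'"
    unfolding F
    by (intro residue_simple_pole_deriv[where s = UNIV] deriv g')
       (use \<open>w \<noteq> 0\<close> in \<open>auto intro!: holomorphic_intros\<close>)
  \<comment> \<open>The factor \<open>1 / w\<close> in \<open>?g'\<close> raises the exponent
    \<open>t - 1\<close> to \<open>t\<close>, and its sign turns \<open>1 - w\<close> into
    \<open>w - 1\<close>.\<close>
  also have "\<dots> = w ^ t / (of_nat (a j) * (?Q w * (w - 1)))"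
  proof -
    have "w ^ t = w * w ^ (t - 1)" using t_pos by (metis power_eq_if less_irrefl)
    thus ?thesis
      using \<open>w \<noteq> 0\<close> w(2) Q a_pos[of j] by (simp add: divide_simps) (simp add: algebra_simps)
  qed
  also have "?Q w = (- 1) ^ (CARD('n) - 1) * (\<Prod>k\<in>UNIV - {j}. w ^ a k - 1)"
    by (subst prod_minus_swap) (simp add: card_Diff_singleton)
  also have "(\<Prod>k\<in>UNIV - {j}. w ^ a k - 1) * (w - 1) =
      (\<Prod>d\<in>#add_mset 1 {# int (a k). k \<in># mset_set (UNIV - {j}) #}. w powi d - 1)"
    by (simp add: image_mset.compositionality comp_def prod_unfold_prod_mset mult.commute)
  hence "(- 1) ^ (CARD('n) - 1) * (\<Prod>k\<in>UNIV - {j}. w ^ a k - 1) * (w - 1) = (- 1) ^ (CARD('n) - 1) *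
      (\<Prod>d\<in>#add_mset 1 {# int (a k). k \<in># mset_set (UNIV - {j}) #}. w powi d - 1)"
    by (simp only: mult.assoc)
  \<comment> \<open>The sign is its own inverse, so it can move out of the denominator.\<close>
  also have "w ^ t / (of_nat (a j) * \<dots>) = (- 1) ^ (CARD('n) - 1) * (1 / of_nat (a j) *
    (w powi int t / (\<Prod>d\<in>#add_mset 1 {# int (a k). k \<in># mset_set (UNIV - {j}) #}. w powi d - 1)))"
    by (cases "even (CARD('n) - 1)") simp_all
  also have "(- 1 :: complex) ^ (CARD('n) - 1) = (- 1) ^ Suc CARD('n)"
    using zero_less_card_finite[where 'a = 'n] by (simp add: minus_one_power_iff)
  finally show ?thesis .
qed

lemma contour_integral_F_fun_residues:
  fixes a :: "'n::finite \<Rightarrow> nat"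
  assumes a_pos: "\<And>k. a k > 0"
    and a_coprime: "\<And>i j. i \<noteq> j \<Longrightarrow> coprime (a i) (a j)"
    and t_pos: "t > 0"
  shows "contour_integral (circlepath 0 2) (F_fun a (int t)) = 2 * pi * \<i> *
    (residue (F_fun a (int t)) 1 + (\<Sum>j\<in>UNIV. \<Sum>w | w ^ a j = 1 \<and> w \<noteq> 1. residue (F_fun a (int t)) w))"
proof -
  let ?F = "F_fun a (int t)"
  let ?W = "\<lambda>j. {w :: complex. w ^ a j = 1 \<and> w \<noteq> 1}"
  let ?pts = "insert 1 (\<Union>j. ?W j)"
  have finW: "finite (?W j)" for j
    using finite_roots_unity[of "a j"] a_pos[of j] by (auto intro: finite_subset[rotated])
  have norm_pts: "norm p = 1" if "p \<in> ?pts" for p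
    using that norm_root_of_unity a_pos by auto
  \<comment> \<open>As \<open>t > 0\<close>, the numerator is a polynomial, so there is no pole at
    0.\<close>
  have "?F = (\<lambda>z. z ^ (t - 1) / ((\<Prod>k\<in>UNIV. 1 - z ^ a k) * (1 - z)))"
    using t_pos by (auto simp: F_fun_def power_int_def nat_diff_distrib fun_eq_iff)
  hence holo: "?F holomorphic_on UNIV - ?pts"
    by (auto intro!: holomorphic_intros)
  have "contour_integral (circlepath 0 2) ?F =
      2 * pi * \<i> * (\<Sum>p\<in>?pts. winding_number (circlepath 0 2) p * residue ?F p)"
    using finW norm_pts by (intro Residue_theorem[OF _ _ _ holo]) fastforce+
  \<comment> \<open>All of \<open>?pts\<close> lies on the unit circle, inside the circle of radius
    2, so the winding numbers are 1.\<close>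
  also have "(\<Sum>p\<in>?pts. winding_number (circlepath 0 2) p * residue ?F p) = (\<Sum>p\<in>?pts. residue ?F p)"
    using norm_pts by (intro sum.cong) (auto simp: winding_number_circlepath)
  also have "\<dots> = residue ?F 1 + (\<Sum>p\<in>(\<Union>j. ?W j). residue ?F p)"
    using finW by (subst sum.insert) auto
  \<comment> \<open>The sets \<open>?W j\<close> are pairwise disjoint by coprimality, so no residue
    is counted twice.\<close>
  also have "(\<Sum>p\<in>(\<Union>j. ?W j). residue ?F p) = (\<Sum>j\<in>UNIV. \<Sum>w\<in>?W j. residue ?F w)"
    by (rule sum.UNION_disjoint) (use finW coprime_roots_of_unity_eq_1 a_coprime in \<open>simp_all, blast\<close>)
  finally show ?thesis .
qed

section \<open>Comparison of the two evaluations of the contour integral\<close>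

theorem theorem2:
  fixes a :: "'n::finite \<Rightarrow> nat" and t :: nat
  assumes a_pos: "\<And>k. a k > 0"
    and a_coprime: "\<And>i j. i \<noteq> j \<Longrightarrow> coprime (a i) (a j)"
    and t_pos: "t > 0"
  shows "lattice_count (interior (weighted_simplex a)) t =
           card {m :: int ^ 'n. (\<forall>k. m $ k > 0) \<and> (\<Sum>k\<in>UNIV. m $ k * int (a k)) < int t}
       \<and> of_nat (lattice_count (interior (weighted_simplex a)) t) =
           (- 1) ^ CARD('n) * R_term a (int t) +
           (\<Sum>j\<in>UNIV. fourier_dedekind (int t)
              (add_mset 1 {# int (a k). k \<in># mset_set (UNIV - {j}) #}) (a j))"
  proof
  let ?L = "lattice_count (interior (weighted_simplex a)) t"
  let ?F = "F_fun a (int t)"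
  let ?S = "\<Sum>j\<in>UNIV. fourier_dedekind (int t)
              (add_mset 1 {# int (a k). k \<in># mset_set (UNIV - {j}) #}) (a j)"
  let ?s = "(- 1 :: complex) ^ Suc CARD('n)"
  show L: "?L = card {m :: int ^ 'n. (\<forall>k. m $ k > 0) \<and> (\<Sum>k\<in>UNIV. m $ k * int (a k)) < int t}"
    by (rule lattice_count_interior_weighted_simplex[OF a_pos t_pos])
  have "(\<Sum>w | w ^ a j = 1 \<and> w \<noteq> 1. residue ?F w) = ?s * fourier_dedekind (int t)
              (add_mset 1 {# int (a k). k \<in># mset_set (UNIV - {j}) #}) (a j)" for j
    unfolding fourier_dedekind_def sum_distrib_left
    by (intro sum.cong refl residue_F_fun_root_of_unity a_pos a_coprime t_pos) auto
  hence "contour_integral (circlepath 0 2) ?F = 2 * pi * \<i> * (residue ?F 1 + ?s * ?S)"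
    by (simp add: contour_integral_F_fun_residues[OF a_pos a_coprime t_pos] sum_distrib_left)
  moreover have "contour_integral (circlepath 0 2) ?F = 2 * pi * \<i> * (?s * of_nat ?L)"
    by (simp only: contour_integral_F_fun[OF a_pos t_pos] L card_positive_int_vectors[OF a_pos]
          fps_nth_prod_geometric[OF finite_class.finite_UNIV a_pos])
  ultimately have "2 * pi * \<i> * (?s * of_nat ?L) = 2 * pi * \<i> * (residue ?F 1 + ?s * ?S)"
    by (metis (no_types))
  hence "?s * of_nat ?L = residue ?F 1 + ?s * ?S"
    by (subst (asm) mult_left_cancel) simp_all
  \<comment> \<open>Multiplying by \<open>?s\<close> removes the sign, since its square is 1. The
    extra -1 in \<open>?s\<close> against \<open>(- 1) ^ CARD('n)\<close> is the minus sign in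
    \<open>R_term\<close>.\<close>
  hence "?s * (?s * of_nat ?L) = ?s * (residue ?F 1 + ?s * ?S)"
    by (rule arg_cong)
  thus "of_nat ?L = (- 1) ^ CARD('n) * R_term a (int t) + ?S"
    by (cases "even CARD('n)") (simp_all add: R_term_def)
qed

end
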